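(* For any monoid homomorphism $\sigma:M\to N$, the subset $\mathrm{Car}(\sigma)$ of $\sigma$-cartesian elements is a submonoid of $M$ which contains the group $M^\times$ of invertible elements of $M$. Moreover, the set $\mathrm{Pcar}(\sigma)$ of $\sigma$-precartesian elements is a left $\mathrm{Car}(\sigma)$-subset of $M$, i.e. $xy\in\mathrm{Pcar}(\sigma)$ whenever $x\in\mathrm{Car}(\sigma)$ and $y\in\mathrm{Pcar}(\sigma)$.
   Context: For a monoid homomorphism $\sigma:M\to N$ with $\mathrm{Ker}(\sigma)=\sigma^{-1}(1)$, an element $x\in M$ is $\sigma$-precartesian if for every $z\in M$ with $\sigma(z)=\sigma(x)$ there is a unique $y\in\mathrm{Ker}(\sigma)$ with $z=xy$. It is $\sigma$-cartesian if (i) for every $z\in M$, $v\in N$ with $\sigma(z)=\sigma(x)v$ there is $y\in M$ with $z=xy$, $\sigma(y)=v$; and (ii) whenever $y_1,y_2\in M$ satisfy $xy_1=xy_2$ and $\sigma(y_1)=\sigma(y_2)$, then $y_1=y_2$. *)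

theory Defs
  imports "HOL-Algebra.Coset"
begin

text \<open>The elements of a monoid that are (pre)cartesian for a map \<open>\<sigma>\<close> from \<open>M\<close> to \<open>N\<close>.
  The library's \<open>kernel M N \<sigma>\<close>, although usually applied to groups, is the preimage
  of \<open>\<one>\<^bsub>N\<^esub>\<close> in the carrier of \<open>M\<close> and hence the kernel wanted here.\<close>

definition precartesian ::
  "('a, 'm) monoid_scheme \<Rightarrow> ('b, 'n) monoid_scheme \<Rightarrow> ('a \<Rightarrow> 'b) \<Rightarrow> 'a \<Rightarrow> bool" where
  "precartesian M N \<sigma> x \<longleftrightarrow>
     x \<in> carrier M \<and>
     (\<forall>z\<in>carrier M. \<sigma> z = \<sigma> x \<longrightarrow> (\<exists>!y. y \<in> kernel M N \<sigma> \<and> z = x \<otimes>\<^bsub>M\<^esub> y))"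

definition cartesian ::
  "('a, 'm) monoid_scheme \<Rightarrow> ('b, 'n) monoid_scheme \<Rightarrow> ('a \<Rightarrow> 'b) \<Rightarrow> 'a \<Rightarrow> bool" where
  "cartesian M N \<sigma> x \<longleftrightarrow>
     x \<in> carrier M \<and>
     (\<forall>z\<in>carrier M. \<forall>v\<in>carrier N. \<sigma> z = \<sigma> x \<otimes>\<^bsub>N\<^esub> v \<longrightarrow>
        (\<exists>y\<in>carrier M. z = x \<otimes>\<^bsub>M\<^esub> y \<and> \<sigma> y = v)) \<and>
     (\<forall>y\<^sub>1\<in>carrier M. \<forall>y\<^sub>2\<in>carrier M.
        x \<otimes>\<^bsub>M\<^esub> y\<^sub>1 = x \<otimes>\<^bsub>M\<^esub> y\<^sub>2 \<and> \<sigma> y\<^sub>1 = \<sigma> y\<^sub>2 \<longrightarrow> y\<^sub>1 = y\<^sub>2)"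

definition Pcar ::
  "('a, 'm) monoid_scheme \<Rightarrow> ('b, 'n) monoid_scheme \<Rightarrow> ('a \<Rightarrow> 'b) \<Rightarrow> 'a set" where
  "Pcar M N \<sigma> = {x. precartesian M N \<sigma> x}"

definition Car ::
  "('a, 'm) monoid_scheme \<Rightarrow> ('b, 'n) monoid_scheme \<Rightarrow> ('a \<Rightarrow> 'b) \<Rightarrow> 'a set" where
  "Car M N \<sigma> = {x. cartesian M N \<sigma> x}"

end

theory Submission
  imports Defs
begin

text \<open>
  An element \<open>x\<close> is cartesian exactly when every equation \<open>z = x y\<close> can be solved for \<open>y\<close>,
  with a unique solution, as soon as \<open>\<sigma> y\<close> is prescribed consistently with \<open>\<sigma> z\<close>. For a
  product \<open>x y\<close> with \<open>x\<close> cartesian one divides in two stages: first by \<open>x\<close>, prescribing the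
  image that the quotient must have in order to be divisible by \<open>y\<close>, and then by \<open>y\<close>.
  Cancellation also proceeds from the left: \<open>x\<close> may be cancelled because the two
  remaining factors have equal images, and this leaves a cancellation of \<open>y\<close>. The second stage
  uses only the property of \<open>y\<close>, so the same argument makes \<open>x y\<close> cartesian when \<open>y\<close> is
  cartesian and precartesian when \<open>y\<close> is precartesian. An invertible element is cartesian since
  multiplication by its inverse performs the division, and \<open>\<one>\<close> is invertible.
\<close>

lemma cartesianI:
  assumes "x \<in> carrier M"
    and "\<And>z v. \<lbrakk>z \<in> carrier M; v \<in> carrier N; \<sigma> z = \<sigma> x \<otimes>\<^bsub>N\<^esub> v\<rbrakk>
      \<Longrightarrow> \<exists>y\<in>carrier M. z = x \<otimes>\<^bsub>M\<^esub> y \<and> \<sigma> y = v"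
    and "\<And>a b. \<lbrakk>a \<in> carrier M; b \<in> carrier M; x \<otimes>\<^bsub>M\<^esub> a = x \<otimes>\<^bsub>M\<^esub> b; \<sigma> a = \<sigma> b\<rbrakk> \<Longrightarrow> a = b"
  shows "cartesian M N \<sigma> x"
  using assms unfolding cartesian_def by blast

lemma cartesian_carrier: "cartesian M N \<sigma> x \<Longrightarrow> x \<in> carrier M"
  by (simp add: cartesian_def)

lemma cartesian_divide:
  assumes "cartesian M N \<sigma> x" "z \<in> carrier M" "v \<in> carrier N" "\<sigma> z = \<sigma> x \<otimes>\<^bsub>N\<^esub> v"
  obtains y where "y \<in> carrier M" "z = x \<otimes>\<^bsub>M\<^esub> y" "\<sigma> y = v"
  using assms unfolding cartesian_def by blast

lemma cartesian_cancel:
  assumes "cartesian M N \<sigma> x" "a \<in> carrier M" "b \<in> carrier M"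
    and "x \<otimes>\<^bsub>M\<^esub> a = x \<otimes>\<^bsub>M\<^esub> b" "\<sigma> a = \<sigma> b"
  shows "a = b"
  using assms unfolding cartesian_def by blast

lemma Units_cartesian:
  assumes "monoid M" "monoid N" and hom: "\<sigma> \<in> hom M N" and one: "\<sigma> \<one>\<^bsub>M\<^esub> = \<one>\<^bsub>N\<^esub>"
    and x: "x \<in> Units M"
  shows "cartesian M N \<sigma> x"
proof -
  interpret M: monoid M by fact
  interpret N: monoid N by fact
  let ?x' = "inv\<^bsub>M\<^esub> x"
  have xc: "x \<in> carrier M" and x'c: "?x' \<in> carrier M"
    using x by auto
  have inv_image: "\<sigma> ?x' \<otimes>\<^bsub>N\<^esub> \<sigma> x = \<one>\<^bsub>N\<^esub>"
    using hom_mult[OF hom x'c xc] x one by simp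
  show ?thesis
  proof (rule cartesianI[OF xc])
    fix z v
    assume z: "z \<in> carrier M" and v: "v \<in> carrier N" and eq: "\<sigma> z = \<sigma> x \<otimes>\<^bsub>N\<^esub> v"
    have "\<sigma> (?x' \<otimes>\<^bsub>M\<^esub> z) = (\<sigma> ?x' \<otimes>\<^bsub>N\<^esub> \<sigma> x) \<otimes>\<^bsub>N\<^esub> v"
      using hom_mult[OF hom x'c z] eq hom_in_carrier[OF hom] xc x'c v
      by (simp add: N.m_assoc)
    also have "\<dots> = v"
      using inv_image v by simp
    finally have "\<sigma> (?x' \<otimes>\<^bsub>M\<^esub> z) = v" .
    moreover have "z = x \<otimes>\<^bsub>M\<^esub> (?x' \<otimes>\<^bsub>M\<^esub> z)"
      using x xc x'c z by (simp flip: M.m_assoc)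
    ultimately show "\<exists>y\<in>carrier M. z = x \<otimes>\<^bsub>M\<^esub> y \<and> \<sigma> y = v"
      using x'c z by blast
  next
    fix a b
    assume "a \<in> carrier M" "b \<in> carrier M" "x \<otimes>\<^bsub>M\<^esub> a = x \<otimes>\<^bsub>M\<^esub> b"
    then show "a = b"
      using x by simp
  qed
qed

lemma cartesian_mult:
  assumes "monoid M" "monoid N" and hom: "\<sigma> \<in> hom M N"
    and x: "cartesian M N \<sigma> x" and y: "cartesian M N \<sigma> y"
  shows "cartesian M N \<sigma> (x \<otimes>\<^bsub>M\<^esub> y)"
proof -
  interpret M: monoid M by fact
  interpret N: monoid N by fact
  note carr = cartesian_carrier[OF x] cartesian_carrier[OF y]
  note img = hom_in_carrier[OF hom]
  show ?thesis
  proof (rule cartesianI)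
    show "x \<otimes>\<^bsub>M\<^esub> y \<in> carrier M"
      using carr by simp
  next
    fix z v
    assume z: "z \<in> carrier M" and v: "v \<in> carrier N"
      and eq: "\<sigma> z = \<sigma> (x \<otimes>\<^bsub>M\<^esub> y) \<otimes>\<^bsub>N\<^esub> v"
    have "\<sigma> z = \<sigma> x \<otimes>\<^bsub>N\<^esub> (\<sigma> y \<otimes>\<^bsub>N\<^esub> v)"
      using eq carr v img by (simp add: hom_mult[OF hom] N.m_assoc)
    moreover have "\<sigma> y \<otimes>\<^bsub>N\<^esub> v \<in> carrier N"
      using carr v img by simp
    ultimately obtain w where w: "w \<in> carrier M" "z = x \<otimes>\<^bsub>M\<^esub> w" "\<sigma> w = \<sigma> y \<otimes>\<^bsub>N\<^esub> v"
      using cartesian_divide[OF x z] by metis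
    obtain u where u: "u \<in> carrier M" "w = y \<otimes>\<^bsub>M\<^esub> u" "\<sigma> u = v"
      using cartesian_divide[OF y w(1) v w(3)] .
    have "z = (x \<otimes>\<^bsub>M\<^esub> y) \<otimes>\<^bsub>M\<^esub> u"
      using w u carr by (simp add: M.m_assoc)
    then show "\<exists>u\<in>carrier M. z = (x \<otimes>\<^bsub>M\<^esub> y) \<otimes>\<^bsub>M\<^esub> u \<and> \<sigma> u = v"
      using u by blast
  next
    fix a b
    assume ab: "a \<in> carrier M" "b \<in> carrier M"
      and eq: "(x \<otimes>\<^bsub>M\<^esub> y) \<otimes>\<^bsub>M\<^esub> a = (x \<otimes>\<^bsub>M\<^esub> y) \<otimes>\<^bsub>M\<^esub> b" and \<sigma>_eq: "\<sigma> a = \<sigma> b"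
    have "y \<otimes>\<^bsub>M\<^esub> a = y \<otimes>\<^bsub>M\<^esub> b"
    proof (rule cartesian_cancel[OF x])
      show "x \<otimes>\<^bsub>M\<^esub> (y \<otimes>\<^bsub>M\<^esub> a) = x \<otimes>\<^bsub>M\<^esub> (y \<otimes>\<^bsub>M\<^esub> b)"
        using eq carr ab by (simp add: M.m_assoc)
      show "\<sigma> (y \<otimes>\<^bsub>M\<^esub> a) = \<sigma> (y \<otimes>\<^bsub>M\<^esub> b)"
        using \<sigma>_eq carr ab by (simp add: hom_mult[OF hom])
    qed (use carr ab in auto)
    then show "a = b"
      using cartesian_cancel[OF y ab] \<sigma>_eq by blast
  qed
qed

text \<open>
  Right multiplication by an element of the kernel does not change images. Hence the image to
  prescribe when dividing \<open>z\<close> by \<open>x\<close> is \<open>\<sigma> y\<close> itself, and the hypothesis on \<open>y\<close> applies to the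
  quotient. For the same reason \<open>x\<close> may be cancelled when comparing two kernel factors.
\<close>

lemma cartesian_mult_precartesian:
  assumes "monoid M" "monoid N" and hom: "\<sigma> \<in> hom M N"
    and x: "cartesian M N \<sigma> x" and y: "precartesian M N \<sigma> y"
  shows "precartesian M N \<sigma> (x \<otimes>\<^bsub>M\<^esub> y)"
proof -
  interpret M: monoid M by fact
  interpret N: monoid N by fact
  have carr: "x \<in> carrier M" "y \<in> carrier M"
    using cartesian_carrier[OF x] y by (auto simp: precartesian_def)
  note img = hom_in_carrier[OF hom]
  have y_unique: "\<exists>!k. k \<in> kernel M N \<sigma> \<and> w = y \<otimes>\<^bsub>M\<^esub> k"
    if "w \<in> carrier M" "\<sigma> w = \<sigma> y" for w
    using y that unfolding precartesian_def by blast
  have ker: "k \<in> carrier M" "\<sigma> (y \<otimes>\<^bsub>M\<^esub> k) = \<sigma> y" if "k \<in> kernel M N \<sigma>" for k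
    using that carr img by (auto simp: kernel_def hom_mult[OF hom])
  have "\<exists>!k. k \<in> kernel M N \<sigma> \<and> z = (x \<otimes>\<^bsub>M\<^esub> y) \<otimes>\<^bsub>M\<^esub> k"
    if z: "z \<in> carrier M" and eq: "\<sigma> z = \<sigma> (x \<otimes>\<^bsub>M\<^esub> y)" for z
  proof (rule ex_ex1I)
    have "\<sigma> z = \<sigma> x \<otimes>\<^bsub>N\<^esub> \<sigma> y"
      using eq carr by (simp add: hom_mult[OF hom])
    then obtain w where w: "w \<in> carrier M" "z = x \<otimes>\<^bsub>M\<^esub> w" "\<sigma> w = \<sigma> y"
      using cartesian_divide[OF x z img[OF carr(2)]] by metis
    obtain k where k: "k \<in> kernel M N \<sigma>" "w = y \<otimes>\<^bsub>M\<^esub> k"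
      using y_unique[OF w(1,3)] by blast
    have "z = (x \<otimes>\<^bsub>M\<^esub> y) \<otimes>\<^bsub>M\<^esub> k"
      using w k ker carr by (simp add: M.m_assoc)
    then show "\<exists>k. k \<in> kernel M N \<sigma> \<and> z = (x \<otimes>\<^bsub>M\<^esub> y) \<otimes>\<^bsub>M\<^esub> k"
      using k by blast
  next
    fix k l
    assume "k \<in> kernel M N \<sigma> \<and> z = (x \<otimes>\<^bsub>M\<^esub> y) \<otimes>\<^bsub>M\<^esub> k"
      and "l \<in> kernel M N \<sigma> \<and> z = (x \<otimes>\<^bsub>M\<^esub> y) \<otimes>\<^bsub>M\<^esub> l"
    then have kl: "k \<in> kernel M N \<sigma>" "l \<in> kernel M N \<sigma>"
      and eq: "(x \<otimes>\<^bsub>M\<^esub> y) \<otimes>\<^bsub>M\<^esub> k = (x \<otimes>\<^bsub>M\<^esub> y) \<otimes>\<^bsub>M\<^esub> l"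
      by auto
    have "y \<otimes>\<^bsub>M\<^esub> k = y \<otimes>\<^bsub>M\<^esub> l"
    proof (rule cartesian_cancel[OF x])
      show "x \<otimes>\<^bsub>M\<^esub> (y \<otimes>\<^bsub>M\<^esub> k) = x \<otimes>\<^bsub>M\<^esub> (y \<otimes>\<^bsub>M\<^esub> l)"
        using eq carr kl ker(1) by (simp add: M.m_assoc)
      show "\<sigma> (y \<otimes>\<^bsub>M\<^esub> k) = \<sigma> (y \<otimes>\<^bsub>M\<^esub> l)"
        using kl ker(2) by simp
    qed (use carr kl ker(1) in auto)
    moreover have "\<exists>!m. m \<in> kernel M N \<sigma> \<and> y \<otimes>\<^bsub>M\<^esub> k = y \<otimes>\<^bsub>M\<^esub> m"
      using y_unique carr kl ker by simp
    ultimately show "k = l"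
      using kl by blast
  qed
  then show ?thesis
    using carr by (simp add: precartesian_def)
qed

theorem corollary3p11:
  fixes M :: "('a, 'm) monoid_scheme"
    and N :: "('b, 'n) monoid_scheme"
    and \<sigma> :: "'a \<Rightarrow> 'b"
  assumes "monoid M"
    and "monoid N"
    and "\<sigma> \<in> hom M N"
    and "\<sigma> \<one>\<^bsub>M\<^esub> = \<one>\<^bsub>N\<^esub>"
  shows "submonoid (Car M N \<sigma>) M
    \<and> Units M \<subseteq> Car M N \<sigma>
    \<and> Pcar M N \<sigma> \<subseteq> carrier M
    \<and> (\<forall>x\<in>Car M N \<sigma>. \<forall>y\<in>Pcar M N \<sigma>. x \<otimes>\<^bsub>M\<^esub> y \<in> Pcar M N \<sigma>)"
proof (intro conjI ballI)
  interpret M: monoid M by fact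
  show units: "Units M \<subseteq> Car M N \<sigma>"
    using Units_cartesian[OF assms] by (auto simp: Car_def)
  show "submonoid (Car M N \<sigma>) M"
  proof
    show "Car M N \<sigma> \<subseteq> carrier M"
      by (auto simp: Car_def cartesian_carrier)
    show "\<one>\<^bsub>M\<^esub> \<in> Car M N \<sigma>"
      using units by blast
    show "x \<otimes>\<^bsub>M\<^esub> y \<in> Car M N \<sigma>" if "x \<in> Car M N \<sigma>" "y \<in> Car M N \<sigma>" for x y
      using that cartesian_mult[OF assms(1-3)] by (simp add: Car_def)
  qed
  show "Pcar M N \<sigma> \<subseteq> carrier M"
    by (auto simp: Pcar_def precartesian_def)
  show "x \<otimes>\<^bsub>M\<^esub> y \<in> Pcar M N \<sigma>" if "x \<in> Car M N \<sigma>" "y \<in> Pcar M N \<sigma>" for x y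
    using that cartesian_mult_precartesian[OF assms(1-3)] by (simp add: Car_def Pcar_def)
qed

end
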